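(* Let $k,\sigma\ge1$. A set $\Pi$ of Parikh vectors of order $k$ over an alphabet of size $\sigma$ is realizable if and only if the subgraph of the Parikh-de-Bruijn grid of order $k$ induced by $\Pi$ is connected.
   Context: Let $\Sigma=\{a_1<\dots<a_\sigma\}$. For a string $u$, $\mathbf{pv}(u)\in\mathbb{N}^\sigma$ has $i$-th entry the number of occurrences of $a_i$ in $u$; the order of a Parikh vector is the sum of its entries; $\mathrm{PV}(k,\sigma)$ is the set of order-$k$ Parikh vectors; $e_i=\mathbf{pv}(a_i)$. Two order-$k$ Parikh vectors $p,q$ are neighbors if $q=p-e_i+e_j$ for some $i\neq j$. The Parikh-de-Bruijn grid of order $k$ is the graph with vertex set $\mathrm{PV}(k,\sigma)$ in which two vertices are adjacent iff they are neighbors (connectivity is the same whether one uses this undirected graph or its directed version with antiparallel edges and loops). For a string $s$, $\Pi_k(s)$ is the set of Parikh vectors of all length-$k$ substrings of $s$. A set $\Pi$ of order-$k$ Parikh vectors is realizable if there is a string $s$ over $\Sigma$ with $\Pi_k(s)=\Pi$. *)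

theory Defs
  imports
    "HOL-Library.Sublist"
    "Jordan_Normal_Form.Matrix"
    "Graph_Theory.Digraph_Component"
begin

text \<open>
  The alphabet is an arbitrary finite set \<open>\<Sigma>\<close> in a linearly ordered type. Indices start at
  \<open>0\<close>: the letter \<open>a\<^sub>i\<close> of the usual notation is \<open>letter \<Sigma> (i - 1)\<close>.
\<close>

definition letter :: "'a::linorder set \<Rightarrow> nat \<Rightarrow> 'a" where
  "letter \<Sigma> i = sorted_list_of_set \<Sigma> ! i"

definition pv :: "'a::linorder set \<Rightarrow> 'a list \<Rightarrow> nat vec" where
  "pv \<Sigma> u = vec (card \<Sigma>) (\<lambda>i. count_list u (letter \<Sigma> i))"

definition pv_order :: "nat vec \<Rightarrow> nat" where
  "pv_order p = (\<Sum>i<dim_vec p. p $ i)"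

definition PV :: "nat \<Rightarrow> nat \<Rightarrow> nat vec set" where
  "PV k \<sigma> = {p \<in> carrier_vec \<sigma>. pv_order p = k}"

lemma pv_letter:
  assumes "finite \<Sigma>" "i < card \<Sigma>"
  shows "pv \<Sigma> [letter \<Sigma> i] = unit_vec (card \<Sigma>) i"
proof (rule eq_vecI)
  fix j assume j: "j < dim_vec (unit_vec (card \<Sigma>) i :: nat vec)"
  have "letter \<Sigma> i = letter \<Sigma> j \<longleftrightarrow> i = j"
    using assms j by (simp add: letter_def nth_eq_iff_index_eq)
  then show "pv \<Sigma> [letter \<Sigma> i] $ j = unit_vec (card \<Sigma>) i $ j"
    using assms j by (simp add: pv_def)
qed (simp add: pv_def)

text \<open>
  \<open>q = p - e\<^sub>i + e\<^sub>j\<close>, with \<open>e\<^sub>i\<close> moved to the other side because subtraction on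
  \<^typ>\<open>nat\<close> is truncated.
\<close>

definition pv_neighbors :: "nat \<Rightarrow> nat vec \<Rightarrow> nat vec \<Rightarrow> bool" where
  "pv_neighbors \<sigma> p q \<longleftrightarrow>
    (\<exists>i<\<sigma>. \<exists>j<\<sigma>. i \<noteq> j \<and> q + unit_vec \<sigma> i = p + unit_vec \<sigma> j)"

text \<open>An undirected edge is a pair of antiparallel arcs.\<close>

definition parikh_grid :: "nat \<Rightarrow> nat \<Rightarrow> (nat vec, nat vec \<times> nat vec) pre_digraph" where
  "parikh_grid k \<sigma> =
    \<lparr>verts = PV k \<sigma>,
     arcs = {(p, q). p \<in> PV k \<sigma> \<and> q \<in> PV k \<sigma> \<and> pv_neighbors \<sigma> p q},
     tail = fst, head = snd\<rparr>"

text \<open>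
  \<^const>\<open>Digraph_Component.connected\<close> excludes the null graph. Here the null graph counts as
  connected: every two of its vertices are joined by a walk. This matches the fact that the empty
  set is realized by every string of length less than \<open>k\<close>.
\<close>

definition graph_connected :: "('v, 'e) pre_digraph \<Rightarrow> bool" where
  "graph_connected G \<longleftrightarrow> verts G = {} \<or> Digraph_Component.connected G"

definition substring_pvs :: "'a::linorder set \<Rightarrow> nat \<Rightarrow> 'a list \<Rightarrow> nat vec set" where
  "substring_pvs \<Sigma> k s = {pv \<Sigma> u | u. sublist u s \<and> length u = k}"

definition realizable :: "'a::linorder set \<Rightarrow> nat \<Rightarrow> nat vec set \<Rightarrow> bool" where
  "realizable \<Sigma> k P \<longleftrightarrow> (\<exists>s \<in> lists \<Sigma>. substring_pvs \<Sigma> k s = P)"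

end

theory Submission
  imports Defs
begin

text \<open>
  Consecutive windows of a string have equal or neighboring Parikh vectors, which gives
  connectedness. Conversely, suppose a string ends in a window \<open>w\<close> with Parikh vector \<open>p\<close>.
  Appending the letters of \<open>w\<close> one after the other rotates the window and produces no new Parikh
  vector. Given a neighbor \<open>q = p - e\<^sub>i + e\<^sub>j\<close>, rotate until \<open>a\<^sub>i\<close> is the first letter of the window
  and append \<open>a\<^sub>j\<close>: the only new Parikh vector is \<open>q\<close>. Hence a string can follow any walk in \<open>P\<close>, in
  particular one that visits all of the finitely many vertices.
\<close>

section \<open>Connectedness as reachability inside a vertex set\<close>

abbreviation nbr_rel :: "nat \<Rightarrow> nat vec rel" where
  "nbr_rel \<sigma> \<equiv> {(p, q). pv_neighbors \<sigma> p q}"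

lemma sym_nbr_rel: "sym (nbr_rel \<sigma>)"
proof (rule symI)
  fix p q assume "(p, q) \<in> nbr_rel \<sigma>"
  then obtain i j where "i < \<sigma>" "j < \<sigma>" "i \<noteq> j"
    "q + unit_vec \<sigma> i = p + unit_vec \<sigma> j"
    by (auto simp: pv_neighbors_def)
  then have "pv_neighbors \<sigma> q p"
    unfolding pv_neighbors_def by (intro exI[of _ j] exI[of _ i] conjI) simp_all
  then show "(q, p) \<in> nbr_rel \<sigma>"
    by simp
qed

text \<open>A path counted by \<open>rtrancl_on A\<close> never leaves \<open>A\<close>, so an arc
  with an end outside \<open>A\<close> cannot occur on it.\<close>

lemma rtrancl_on_Int_Times: "rtrancl_on A (r \<inter> A \<times> A) = rtrancl_on A r"
proof (intro equalityI subrelI)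
  fix a b assume "(a, b) \<in> rtrancl_on A r"
  then show "(a, b) \<in> rtrancl_on A (r \<inter> A \<times> A)"
    by (induct rule: rtrancl_on_induct) (auto intro: rtrancl_on_into_rtrancl_on)
next
  fix a b assume "(a, b) \<in> rtrancl_on A (r \<inter> A \<times> A)"
  then show "(a, b) \<in> rtrancl_on A r"
    by (rule rtrancl_on_mono[OF Int_lower1 subset_refl])
qed

lemma graph_connected_parikh_grid_iff:
  assumes "P \<subseteq> PV k \<sigma>"
  shows "graph_connected (parikh_grid k \<sigma> \<restriction> P) \<longleftrightarrow> P \<times> P \<subseteq> rtrancl_on P (nbr_rel \<sigma>)"
proof -
  \<comment> \<open>\<open>connected\<close> means strong connectedness of the symmetric closure,
    which adds no arcs here because the neighbor relation is symmetric.\<close>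
  have "parcs (mk_symmetric (parikh_grid k \<sigma> \<restriction> P)) = nbr_rel \<sigma> \<inter> P \<times> P"
    using assms sym_nbr_rel[of \<sigma>]
    by (fastforce simp: parcs_mk_symmetric parikh_grid_def sym_def)
  then show ?thesis
    by (auto simp: graph_connected_def connected_def strongly_connected_def reachable_def
        rtrancl_on_Int_Times)
qed

text \<open>Lets an induction on strings add one vertex per appended letter. Here \<open>p\<close>
  is a hub that reaches every vertex, and symmetry of \<open>r\<close> joins any two vertices
  through it.\<close>

lemma rtrancl_on_insert_total:
  assumes "sym r" "A \<times> A \<subseteq> rtrancl_on A r" "p \<in> A" "(p, q) \<in> r"
  shows "insert q A \<times> insert q A \<subseteq> rtrancl_on (insert q A) r"
proof -
  let ?R = "rtrancl_on (insert q A) r"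
  have "(p, x) \<in> ?R" if "x \<in> insert q A" for x
    using that assms rtrancl_on_mono[of r r A "insert q A" p x]
    by (auto intro: rtrancl_on_into_rtrancl_on[of p p])
  moreover have "sym ?R"
    using assms(1) by (rule rtrancl_on_sym)
  ultimately have "(x, y) \<in> ?R" if "x \<in> insert q A" "y \<in> insert q A" for x y
    using that by (meson rtrancl_on_trans symD)
  then show ?thesis
    by blast
qed

section \<open>Parikh vectors of strings\<close>

lemma dim_pv [simp]: "dim_vec (pv \<Sigma> u) = card \<Sigma>"
  by (simp add: pv_def)

lemma pv_append_commute: "pv \<Sigma> (u @ v) = pv \<Sigma> (v @ u)"
  by (auto simp: pv_def)

lemma letter_in: "finite \<Sigma> \<Longrightarrow> i < card \<Sigma> \<Longrightarrow> letter \<Sigma> i \<in> \<Sigma>"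
  unfolding letter_def
  by (metis nth_mem set_sorted_list_of_set length_sorted_list_of_set)

lemma letter_eq_iff:
  "finite \<Sigma> \<Longrightarrow> i < card \<Sigma> \<Longrightarrow> j < card \<Sigma> \<Longrightarrow> letter \<Sigma> i = letter \<Sigma> j \<longleftrightarrow> i = j"
  by (simp add: letter_def nth_eq_iff_index_eq)

lemma letter_cases:
  assumes "finite \<Sigma>" "c \<in> \<Sigma>"
  obtains i where "i < card \<Sigma>" "c = letter \<Sigma> i"
  using assms unfolding letter_def
  by (metis in_set_conv_nth set_sorted_list_of_set length_sorted_list_of_set)

text \<open>Supplies the first window of the realizing string and the finiteness of the grid. The
  witness is sorted: one block of equal letters per index.\<close>

lemma pv_surj:
  assumes "finite \<Sigma>" "p \<in> PV k (card \<Sigma>)"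
  obtains w where "w \<in> lists \<Sigma>" "length w = k" "pv \<Sigma> w = p"
proof -
  define f where "f i = replicate (p $ i) (letter \<Sigma> i)" for i
  define w where "w = concat (map f [0..<card \<Sigma>])"
  have p: "dim_vec p = card \<Sigma>" "(\<Sum>i<card \<Sigma>. p $ i) = k"
    using assms(2) by (auto simp: PV_def pv_order_def)
  have "set w \<subseteq> \<Sigma>"
    using letter_in[OF assms(1)] by (auto simp: w_def f_def)
  moreover have "length w = k"
    using p by (simp add: w_def f_def length_concat comp_def interv_sum_list_conv_sum_set_nat
        lessThan_atLeast0)
  moreover have "count_list w (letter \<Sigma> j) = p $ j" if j: "j < card \<Sigma>" for j
  proof -
    \<comment> \<open>Restricting to the first \<open>n\<close> blocks allows induction: block
      \<open>n\<close> contributes to letter \<open>j\<close> only if \<open>j = n\<close>.\<close>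
    have "count_list (concat (map f [0..<n])) (letter \<Sigma> j) = (if j < n then p $ j else 0)"
      if "n \<le> card \<Sigma>" for n
      using that
    proof (induction n)
      case (Suc n)
      have "count_list (f n) (letter \<Sigma> j) = (if j = n then p $ j else 0)"
        using Suc.prems j letter_eq_iff[OF assms(1), of j n]
        by (auto simp: f_def count_list_eq_length_filter)
      then show ?case
        using Suc by auto
    qed simp
    then show ?thesis
      using j by (simp add: w_def)
  qed
  then have "pv \<Sigma> w = p"
    using p by (auto simp: pv_def)
  ultimately show ?thesis
    using that by auto
qed

lemma finite_PV:
  fixes \<Sigma> :: "'a::linorder set"
  assumes fin: "finite \<Sigma>"
  shows "finite (PV k (card \<Sigma>))"
proof -
  have "PV k (card \<Sigma>) \<subseteq> pv \<Sigma> ` {w. set w \<subseteq> \<Sigma> \<and> length w = k}"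
  proof
    fix p assume "p \<in> PV k (card \<Sigma>)"
    with fin show "p \<in> pv \<Sigma> ` {w. set w \<subseteq> \<Sigma> \<and> length w = k}"
      by (elim pv_surj) auto
  qed
  then show ?thesis
    using finite_lists_length_eq[OF fin] by (meson finite_imageI finite_subset)
qed

section \<open>The windows of a string\<close>

lemma substring_pvs_short: "length s < k \<Longrightarrow> substring_pvs \<Sigma> k s = {}"
  by (auto simp: substring_pvs_def dest: sublist_length_le)

text \<open>A substring of a nonempty string is a suffix of it or a substring of its
  \<open>butlast\<close>, and the only suffix of length \<open>k\<close> is
  \<open>w\<close>.\<close>

lemma substring_pvs_last_window:
  assumes "length w = k"
  shows "substring_pvs \<Sigma> k (r @ w) = insert (pv \<Sigma> w) (substring_pvs \<Sigma> k (butlast (r @ w)))"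
proof (cases "r @ w" rule: rev_cases)
  \<comment> \<open>Here \<open>k = 0\<close> and \<open>butlast [] = []\<close>, so the empty
    window is already counted.\<close>
  case Nil
  then show ?thesis
    using assms by (auto simp: substring_pvs_def)
next
  case (snoc s c)
  have "suffix u (r @ w) \<longleftrightarrow> u = w" if "length u = k" for u
    using that assms by (auto simp: suffix_def)
  then show ?thesis
    using assms unfolding substring_pvs_def snoc sublist_snoc butlast_snoc by blast
qed

lemma substring_pvs_full:
  assumes "length w = k"
  shows "substring_pvs \<Sigma> k w = {pv \<Sigma> w}"
proof -
  have "u = w" if "sublist u w" "length u = k" for u
    using that assms unfolding sublist_def by auto
  then have "{u. sublist u w \<and> length u = k} = {w}"
    using assms by auto
  then show ?thesis
    by (simp add: substring_pvs_def setcompr_eq_image)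
qed

lemma substring_pvs_shift:
  assumes "length (x # w) = k"
  shows "substring_pvs \<Sigma> k (r @ x # w @ [c]) =
    insert (pv \<Sigma> (w @ [c])) (substring_pvs \<Sigma> k (r @ x # w))"
  using assms substring_pvs_last_window[of "w @ [c]" k \<Sigma> "r @ [x]"] by (simp add: butlast_append)

text \<open>The letters of \<open>u\<close> are appended one by one. Each slide turns the prefix
  into \<open>r @ [x]\<close> and the rest of the window into \<open>v @ [x]\<close>, so
  \<open>r\<close> and \<open>v\<close> are generalised. The new window is a rotation of the old
  one, hence has the same Parikh vector.\<close>

lemma substring_pvs_rotate:
  "length (u @ v) = k \<Longrightarrow> substring_pvs \<Sigma> k (r @ u @ v @ u) = substring_pvs \<Sigma> k (r @ u @ v)"
proof (induction u arbitrary: r v)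
  case (Cons x u)
  have "substring_pvs \<Sigma> k ((r @ [x]) @ u @ (v @ [x]) @ u) =
      substring_pvs \<Sigma> k ((r @ [x]) @ u @ v @ [x])"
    using Cons.prems by (intro Cons.IH) simp
  also have "\<dots> = insert (pv \<Sigma> (u @ v @ [x])) (substring_pvs \<Sigma> k (r @ x # u @ v))"
    using substring_pvs_shift[of x "u @ v" k \<Sigma> r x] Cons.prems by simp
  also have "pv \<Sigma> (u @ v @ [x]) = pv \<Sigma> (x # u @ v)"
    using pv_append_commute[of \<Sigma> "u @ v" "[x]"] by simp
  also have "insert \<dots> (substring_pvs \<Sigma> k (r @ x # u @ v)) = substring_pvs \<Sigma> k (r @ x # u @ v)"
    using substring_pvs_last_window[of "x # u @ v" k \<Sigma> r] Cons.prems by auto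
  finally show ?case
    by simp
qed simp

section \<open>Realizable sets are connected\<close>

lemma pv_shift_neighbors:
  assumes "finite \<Sigma>" "x \<in> \<Sigma>" "c \<in> \<Sigma>"
  shows "pv \<Sigma> (w @ [c]) = pv \<Sigma> (x # w) \<or> pv_neighbors (card \<Sigma>) (pv \<Sigma> (x # w)) (pv \<Sigma> (w @ [c]))"
proof (cases "x = c")
  case True
  then show ?thesis
    using pv_append_commute[of \<Sigma> w "[c]"] by simp
next
  case False
  obtain i j where ij: "i < card \<Sigma>" "x = letter \<Sigma> i" "j < card \<Sigma>" "c = letter \<Sigma> j"
    using assms by (metis letter_cases)
  \<comment> \<open>Both sides count the letters of \<open>w\<close>, \<open>x\<close> and
    \<open>c\<close>; this is the subtraction-free form in \<open>pv_neighbors\<close>.\<close>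
  have "pv \<Sigma> (w @ [c]) + pv \<Sigma> [x] = pv \<Sigma> (x # w) + pv \<Sigma> [c]"
    by (auto simp: pv_def)
  then show ?thesis
    using False assms(1) ij pv_letter unfolding pv_neighbors_def by metis
qed

lemma substring_pvs_connected:
  assumes "finite \<Sigma>" "k \<ge> 1" "s \<in> lists \<Sigma>"
  defines "A \<equiv> substring_pvs \<Sigma> k"
  shows "A s \<times> A s \<subseteq> rtrancl_on (A s) (nbr_rel (card \<Sigma>))"
  using assms(3)
proof (induction s rule: rev_induct)
  case Nil
  then show ?case
    using assms(2) by (simp add: A_def substring_pvs_short)
next
  case (snoc c s)
  consider "length s + 1 < k" | "length s + 1 = k" | "length s \<ge> k"
    by linarith
  then show ?case
  proof cases
    case 1
    then show ?thesis by (simp add: A_def substring_pvs_short)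
  next
    case 2
    then show ?thesis by (simp add: A_def substring_pvs_full)
  next
    case 3
    \<comment> \<open>Isolate the last window of \<open>s\<close>; since \<open>k \<ge> 1\<close> it
      has a first letter \<open>x\<close>, which leaves when \<open>c\<close> enters.\<close>
    define r where "r = take (length s - k) s"
    obtain x w where xw: "drop (length s - k) s = x # w"
      using 3 assms(2) by (cases "drop (length s - k) s") auto
    have s: "s = r @ x # w"
      unfolding r_def by (metis append_take_drop_id xw)
    have len: "length (x # w) = k"
      using 3 unfolding xw[symmetric] by simp
    have ins: "A (s @ [c]) = insert (pv \<Sigma> (w @ [c])) (A s)"
      using substring_pvs_shift[OF len] by (simp add: s A_def)
    have last: "pv \<Sigma> (x # w) \<in> A s"
      using substring_pvs_last_window[OF len] by (simp add: s A_def)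
    have "x \<in> \<Sigma>" "c \<in> \<Sigma>"
      using snoc.prems by (auto simp: s)
    have IH: "A s \<times> A s \<subseteq> rtrancl_on (A s) (nbr_rel (card \<Sigma>))"
      using snoc by simp
    from \<open>x \<in> \<Sigma>\<close> \<open>c \<in> \<Sigma>\<close> consider "pv \<Sigma> (w @ [c]) = pv \<Sigma> (x # w)"
      | "(pv \<Sigma> (x # w), pv \<Sigma> (w @ [c])) \<in> nbr_rel (card \<Sigma>)"
      using pv_shift_neighbors[OF assms(1)] by blast
    then show ?thesis
    proof cases
      case 1
      then show ?thesis
        unfolding ins using last IH by (simp add: insert_absorb)
    next
      case 2
      then show ?thesis
        unfolding ins by (rule rtrancl_on_insert_total[OF sym_nbr_rel IH last])
    qed
  qed
qed

section \<open>Connected sets are realizable\<close>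

lemma extend_to_neighbor:
  assumes "finite \<Sigma>" "r @ w \<in> lists \<Sigma>" "length w = k" "q \<in> carrier_vec (card \<Sigma>)"
    and "pv_neighbors (card \<Sigma>) (pv \<Sigma> w) q"
  obtains r' w' where "r' @ w' \<in> lists \<Sigma>" "length w' = k" "pv \<Sigma> w' = q"
    "substring_pvs \<Sigma> k (r' @ w') = insert q (substring_pvs \<Sigma> k (r @ w))"
proof -
  obtain i j where ij: "i < card \<Sigma>" "j < card \<Sigma>" "i \<noteq> j"
    and eq: "q + unit_vec (card \<Sigma>) i = pv \<Sigma> w + unit_vec (card \<Sigma>) j"
    using assms(5) unfolding pv_neighbors_def by blast
  let ?a = "letter \<Sigma> i" and ?b = "letter \<Sigma> j"
  \<comment> \<open>Since \<open>i \<noteq> j\<close>, entry \<open>i\<close> shows that the window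
    contains \<open>?a\<close>, the letter to be dropped.\<close>
  have "(q + unit_vec (card \<Sigma>) i) $ i = (pv \<Sigma> w + unit_vec (card \<Sigma>) j) $ i"
    by (simp add: eq)
  then have "count_list w ?a = Suc (q $ i)"
    using ij by (simp add: pv_def)
  then have "?a \<in> set w"
    by (metis count_notin Zero_not_Suc)
  then obtain u v where w: "w = u @ ?a # v"
    by (auto dest: split_list)
  \<comment> \<open>After appending \<open>u\<close> the window is \<open>?a # v @ u\<close>;
    appending \<open>?b\<close> then yields \<open>v @ u @ [?b]\<close>.\<close>
  have "pv \<Sigma> (v @ u @ [?b]) + pv \<Sigma> [?a] = pv \<Sigma> w + pv \<Sigma> [?b]"
    unfolding w by (auto simp: pv_def)
  then have "pv \<Sigma> (v @ u @ [?b]) + unit_vec (card \<Sigma>) i = q + unit_vec (card \<Sigma>) i"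
    using eq ij assms(1) by (simp add: pv_letter)
  then have q: "pv \<Sigma> (v @ u @ [?b]) = q"
    using assms(4) by (auto simp: vec_eq_iff)
  have "substring_pvs \<Sigma> k ((r @ u) @ ?a # (v @ u) @ [?b]) =
      insert q (substring_pvs \<Sigma> k (r @ u @ (?a # v) @ u))"
    using substring_pvs_shift[of ?a "v @ u" k \<Sigma> "r @ u" ?b] assms(3) q by (simp add: w)
  also have "substring_pvs \<Sigma> k (r @ u @ (?a # v) @ u) = substring_pvs \<Sigma> k (r @ w)"
    using substring_pvs_rotate[of u "?a # v" k \<Sigma> r] assms(3) by (simp add: w)
  finally show ?thesis
    using that[of "r @ u @ [?a]" "v @ u @ [?b]"] assms(2,3) q letter_in[OF assms(1)] ij
    by (simp add: w)
qed

text \<open>The invariant keeps the current vertex as the last window, so that the next arc can be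
  followed, and keeps all vectors collected so far without leaving \<open>P\<close>.\<close>

lemma extend_along_walk:
  assumes "finite \<Sigma>" "P \<subseteq> PV k (card \<Sigma>)" "(p, q) \<in> rtrancl_on P (nbr_rel (card \<Sigma>))"
    and "r @ w \<in> lists \<Sigma>" "length w = k" "pv \<Sigma> w = p" "substring_pvs \<Sigma> k (r @ w) \<subseteq> P"
  shows "\<exists>r' w'. r' @ w' \<in> lists \<Sigma> \<and> length w' = k \<and> pv \<Sigma> w' = q \<and>
    substring_pvs \<Sigma> k (r @ w) \<subseteq> substring_pvs \<Sigma> k (r' @ w') \<and>
    substring_pvs \<Sigma> k (r' @ w') \<subseteq> P"
  using assms(3)
proof (induction rule: rtrancl_on_induct)
  case base
  then show ?case
    using assms by blast
next
  case (step y z)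
  then obtain r' w' where y: "r' @ w' \<in> lists \<Sigma>" "length w' = k" "pv \<Sigma> w' = y"
    "substring_pvs \<Sigma> k (r @ w) \<subseteq> substring_pvs \<Sigma> k (r' @ w')"
    "substring_pvs \<Sigma> k (r' @ w') \<subseteq> P"
    by blast
  have "z \<in> carrier_vec (card \<Sigma>)"
    using step assms(2) by (auto simp: PV_def)
  moreover have "pv_neighbors (card \<Sigma>) (pv \<Sigma> w') z"
    using step y by simp
  ultimately obtain r'' w'' where "r'' @ w'' \<in> lists \<Sigma>" "length w'' = k" "pv \<Sigma> w'' = z"
    "substring_pvs \<Sigma> k (r'' @ w'') = insert z (substring_pvs \<Sigma> k (r' @ w'))"
    using extend_to_neighbor[OF assms(1) y(1,2)] by metis
  then show ?case
    using y(4,5) step(4) by (intro exI[of _ r''] exI[of _ w'']) auto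
qed

lemma connected_imp_realizable:
  assumes "finite \<Sigma>" "k \<ge> 1" "P \<subseteq> PV k (card \<Sigma>)" "P \<times> P \<subseteq> rtrancl_on P (nbr_rel (card \<Sigma>))"
  shows "realizable \<Sigma> k P"
proof (cases "P = {}")
  case True
  then show ?thesis
    using assms(2) substring_pvs_short[of "[]" k \<Sigma>] unfolding realizable_def
    by (intro bexI[of _ "[]"]) auto
next
  case False
  then obtain p where p: "p \<in> P" by blast
  \<comment> \<open>The end of the string is left open: the last window always lies in
    \<open>P\<close>, so connectedness gives a walk from it to the next target. Taking
    \<open>F = P\<close> gives equality.\<close>
  have *: "\<exists>r w. r @ w \<in> lists \<Sigma> \<and> length w = k \<and> F \<subseteq> substring_pvs \<Sigma> k (r @ w) \<and>
      substring_pvs \<Sigma> k (r @ w) \<subseteq> P" if "finite F" "F \<subseteq> P" for F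
    using that
  proof (induction F)
    \<comment> \<open>Even with no target yet, one window is needed as a starting vertex for later
      walks.\<close>
    case empty
    obtain w where "w \<in> lists \<Sigma>" "length w = k" "pv \<Sigma> w = p"
      using pv_surj assms(1,3) p by blast
    then show ?case
      using p substring_pvs_full[of w k \<Sigma>] by (intro exI[of _ "[]"] exI[of _ w]) auto
  next
    case (insert q F)
    then obtain r w where rw: "r @ w \<in> lists \<Sigma>" "length w = k"
      "F \<subseteq> substring_pvs \<Sigma> k (r @ w)" "substring_pvs \<Sigma> k (r @ w) \<subseteq> P"
      by auto
    have "pv \<Sigma> w \<in> P"
      using rw substring_pvs_last_window[OF rw(2)] by auto
    then have "(pv \<Sigma> w, q) \<in> rtrancl_on P (nbr_rel (card \<Sigma>))"
      using assms(4) insert.prems by auto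
    from extend_along_walk[OF assms(1,3) this rw(1,2) refl rw(4)]
    obtain r' w' where rw': "r' @ w' \<in> lists \<Sigma>" "length w' = k" "pv \<Sigma> w' = q"
      "substring_pvs \<Sigma> k (r @ w) \<subseteq> substring_pvs \<Sigma> k (r' @ w')"
      "substring_pvs \<Sigma> k (r' @ w') \<subseteq> P"
      by blast
    have "q \<in> substring_pvs \<Sigma> k (r' @ w')"
      using rw'(3) substring_pvs_last_window[OF rw'(2)] by auto
    then show ?case
      using rw rw' by (intro exI[of _ r'] exI[of _ w']) auto
  qed
  have "finite P"
    using finite_PV[OF assms(1)] assms(3) by (rule finite_subset[rotated])
  from *[OF this subset_refl] show ?thesis
    unfolding realizable_def by (metis subset_antisym)
qed

theorem theorem2:
  fixes \<Sigma> :: "'a::linorder set" and k \<sigma> :: nat and P :: "nat vec set"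
  assumes "k \<ge> 1" and "\<sigma> \<ge> 1"
    and "finite \<Sigma>" and "card \<Sigma> = \<sigma>"
    and "P \<subseteq> PV k \<sigma>"
  shows "realizable \<Sigma> k P \<longleftrightarrow> graph_connected (parikh_grid k \<sigma> \<restriction> P)"
proof -
  have "P \<times> P \<subseteq> rtrancl_on P (nbr_rel \<sigma>)" if "realizable \<Sigma> k P"
  proof -
    from that obtain s where "s \<in> lists \<Sigma>" "substring_pvs \<Sigma> k s = P"
      unfolding realizable_def by blast
    then show ?thesis
      using substring_pvs_connected[OF assms(3,1)] assms(4) by metis
  qed
  moreover have "realizable \<Sigma> k P" if "P \<times> P \<subseteq> rtrancl_on P (nbr_rel \<sigma>)"
    using connected_imp_realizable[OF assms(3,1)] assms(4,5) that by metis
  ultimately show ?thesis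
    unfolding graph_connected_parikh_grid_iff[OF assms(5)] by blast
qed

end
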